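(* There is a universal constant $c_0>0$ such that for every $n\in\mathbb{N}$ and every $\varepsilon\in(0,1/2)$, $$c_2\left(\mathbb{H}_n,d_{N_0}^{1-\varepsilon}\right)\ge\frac{c_0}{\sqrt{\varepsilon}}.$$
   Context: $\mathbb{N}=\{1,2,\dots\}$. For $n\in\mathbb{N}$ the $n$-th Heisenberg group $\mathbb{H}_n$ is $\mathbb{C}^n\times\mathbb{R}$ with the group product $(w,s)\cdot(z,t)=\left(w+z,\ s+t+2\sum_{j=1}^n\operatorname{Im}(w_j\overline{z_j})\right)$; its identity is $(0,0)$ and $(z,t)^{-1}=(-z,-t)$. The Koranyi norm is $N_0(z,t)=\sqrt[4]{|z|^4+t^2}$, where $|z|^2=\sum_{j=1}^n|z_j|^2$, and $d_{N_0}(g,h)=N_0(h^{-1}g)$, which is a left-invariant metric on $\mathbb{H}_n$. For a metric space $(X,\rho)$, $c_2(X,\rho)$ (the Euclidean distortion) is the infimum of those $D\ge1$ for which there is $f:X\to\ell_2$ with $\rho(x,y)\le\|f(x)-f(y)\|\le D\rho(x,y)$ for all $x,y\in X$, where $\ell_2$ is infinite dimensional Hilbert space. *)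

theory Defs
  imports "HOL-Analysis.Analysis"
begin

section \<open>Heisenberg groups\<close>

text \<open>
  The dimension \<open>n\<close> must be quantified inside the statement (the constant does not depend on it),
  so a vector of \<open>\<complex>\<^sup>n\<close> is a function \<open>nat \<Rightarrow> complex\<close> that vanishes outside \<open>{1..n}\<close>.
\<close>

type_synonym heis = "(nat \<Rightarrow> complex) \<times> real"

definition heisenberg :: "nat \<Rightarrow> heis set" where
  "heisenberg n = {z. \<forall>j. j \<notin> {1..n} \<longrightarrow> z j = 0} \<times> UNIV"

fun heis_mult :: "nat \<Rightarrow> heis \<Rightarrow> heis \<Rightarrow> heis" where
  "heis_mult n (w, s) (z, t) =
     ((\<lambda>j. w j + z j), s + t + 2 * (\<Sum>j=1..n. Im (w j * cnj (z j))))"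

definition heis_one :: heis where
  "heis_one = ((\<lambda>_. 0), 0)"

fun heis_inv :: "heis \<Rightarrow> heis" where
  "heis_inv (z, t) = ((\<lambda>j. - z j), - t)"

lemma heis_closed:
  "heis_one \<in> heisenberg n"
  "g \<in> heisenberg n \<Longrightarrow> heis_inv g \<in> heisenberg n"
  "g \<in> heisenberg n \<Longrightarrow> h \<in> heisenberg n \<Longrightarrow> heis_mult n g h \<in> heisenberg n"
  by (cases g; cases h; auto simp: heisenberg_def heis_one_def)+

lemma heis_mult_assoc:
  "heis_mult n (heis_mult n g h) k = heis_mult n g (heis_mult n h k)"
  by (cases g; cases h; cases k)
     (simp add: fun_eq_iff algebra_simps sum.distrib sum_subtractf)

lemma heis_mult_one:
  "heis_mult n heis_one g = g" "heis_mult n g heis_one = g"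
  by (cases g; simp add: heis_one_def)+

lemma heis_mult_inv:
  "heis_mult n (heis_inv g) g = heis_one" "heis_mult n g (heis_inv g) = heis_one"
  by (cases g; simp add: heis_one_def mult.commute)+

fun koranyi_norm :: "nat \<Rightarrow> heis \<Rightarrow> real" where
  "koranyi_norm n (z, t) = root 4 (L2_set (\<lambda>j. cmod (z j)) {1..n} ^ 4 + t\<^sup>2)"

definition koranyi_dist :: "nat \<Rightarrow> heis \<Rightarrow> heis \<Rightarrow> real" where
  "koranyi_dist n g h = koranyi_norm n (heis_mult n (heis_inv h) g)"


section \<open>Euclidean distortion\<close>

definition ell2 :: "(nat \<Rightarrow> real) set" where
  "ell2 = {a. summable (\<lambda>k. (a k)\<^sup>2)}"

definition ell2_norm :: "(nat \<Rightarrow> real) \<Rightarrow> real" where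
  "ell2_norm a = sqrt (\<Sum>k. (a k)\<^sup>2)"

text \<open>
  The infimum is taken in \<open>ereal\<close>, so that the distortion of a space
  without a bi-Lipschitz embedding into \<open>ell2\<close> is \<open>\<infinity>\<close>.
\<close>

definition euclidean_distortion :: "'a set \<Rightarrow> ('a \<Rightarrow> 'a \<Rightarrow> real) \<Rightarrow> ereal" where
  "euclidean_distortion X \<rho> =
     Inf {ereal D | D. D \<ge> 1 \<and>
            (\<exists>f \<in> X \<rightarrow> ell2. \<forall>x\<in>X. \<forall>y\<in>X.
               \<rho> x y \<le> ell2_norm (\<lambda>k. f x k - f y k) \<and>
               ell2_norm (\<lambda>k. f x k - f y k) \<le> D * \<rho> x y)}"

end

theory Submission
  imports Defs
begin

text \<open>
  The integer Heisenberg group sits in every \<open>heisenberg n\<close> in the coordinates \<open>heis_pt\<close>, where the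
  two generators act by right multiplication as \<open>A = (x+1, y, z)\<close>, \<open>B = (x, y+1, z-x)\<close> and the center
  as \<open>C = (x, y, z+1)\<close>. For a finitely supported \<open>F\<close> one has the vertical versus horizontal inequality
  \<open>(\<Sum>j<J. 4^(-j) \<parallel>C^(4^j) F - F\<parallel>\<^sup>2) \<le> 27 (\<parallel>A F - F\<parallel>\<^sup>2 + \<parallel>B F - F\<parallel>\<^sup>2)\<close>.
  Indeed, after a Fourier transform in \<open>z\<close> the operators \<open>A\<close>, \<open>B\<close> commute up to a phase
  \<open>cis \<theta>\<close>, and pairing \<open>AB - BA = (A-1)(B-1) - (B-1)(A-1)\<close> with \<open>F\<close> bounds
  \<open>\<bar>cis \<theta> - 1\<bar> \<parallel>F\<parallel>\<^sup>2\<close> by \<open>\<parallel>A F - F\<parallel>\<^sup>2 + \<parallel>B F - F\<parallel>\<^sup>2\<close>.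
  Apply this to an embedding of the snowflake, cut off to a box of side \<open>2^J\<close> (and height \<open>4^J\<close>) with
  \<open>J\<close> about \<open>1/\<epsilon>\<close>: up to this scale the exponent \<open>1 - \<epsilon>\<close> costs only a constant factor, so each of the
  \<open>J\<close> vertical scales contributes a constant, while the horizontal side is at most a constant times
  \<open>D\<^sup>2\<close>. Hence \<open>1/\<epsilon> \<lesssim> D\<^sup>2\<close>.
\<close>

section \<open>The vertical versus horizontal inequality\<close>

text \<open>Both sides truncate the same sum over the whole type to \<open>T\<close>; the two
  support conditions say that truncation loses nothing before or after the bijection.\<close>

lemma sum_shift_invariant:
  fixes g :: "'a \<Rightarrow> 'b::comm_monoid_add"
  assumes "finite T" "bij s" "\<And>p. g p \<noteq> 0 \<Longrightarrow> p \<in> T" "\<And>p. g (s p) \<noteq> 0 \<Longrightarrow> p \<in> T"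
  shows "(\<Sum>p\<in>T. g (s p)) = (\<Sum>p\<in>T. g p)"
proof -
  have "(\<Sum>p\<in>T. g (s p)) = (\<Sum>q\<in>s ` T. g q)"
    using assms(2) by (simp add: sum.reindex bij_is_inj inj_on_subset[OF bij_is_inj])
  also have "\<dots> = (\<Sum>q\<in>s ` T \<union> T. g q)"
  proof (rule sum.mono_neutral_left)
    show "\<forall>i\<in>s ` T \<union> T - s ` T. g i = 0"
    proof
      fix i assume i: "i \<in> s ` T \<union> T - s ` T"
      obtain p where "i = s p" using assms(2) by (metis bij_pointE)
      with i assms(4) show "g i = 0" by auto
    qed
  qed (use assms in auto)
  also have "\<dots> = (\<Sum>q\<in>T. g q)"
    by (rule sum.mono_neutral_right) (use assms in auto)
  finally show ?thesis .
qed

section \<open>Elementary quadratic inequalities\<close>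

lemma norm_sum_power2_le:
  fixes a b :: "'a::real_normed_vector"
  shows "(norm (a + b))\<^sup>2 \<le> 2 * (norm a)\<^sup>2 + 2 * (norm b)\<^sup>2"
proof -
  have "(norm (a + b))\<^sup>2 \<le> (norm a + norm b)\<^sup>2"
    by (intro power_mono norm_triangle_ineq) simp
  also have "\<dots> \<le> 2 * (norm a)\<^sup>2 + 2 * (norm b)\<^sup>2"
    using sum_squares_bound[of "norm a" "norm b"] by (simp add: power2_sum)
  finally show ?thesis .
qed

lemma Re_mult_cnj_le:
  assumes "cmod v = 1"
  shows "Re (v * a * cnj b) \<le> ((cmod a)\<^sup>2 + (cmod b)\<^sup>2) / 2"
proof -
  have "Re (v * a * cnj b) \<le> cmod (v * a * cnj b)" by (rule complex_Re_le_cmod)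
  also have "\<dots> = cmod a * cmod b" using assms by (simp add: norm_mult)
  also have "\<dots> \<le> ((cmod a)\<^sup>2 + (cmod b)\<^sup>2) / 2"
    using sum_squares_bound[of "cmod a" "cmod b"] by simp
  finally show ?thesis .
qed

lemma Re_mult_cnj_ge: "Re (p * cnj q) = ((cmod p)\<^sup>2 + (cmod q)\<^sup>2 - (cmod (p - q))\<^sup>2) / 2"
  unfolding cmod_power2 by (simp add: power2_eq_square algebra_simps)

text \<open>At the central frequency \<open>\<theta>\<close> the generators act by
  \<open>A G = G (x+1) y\<close> and \<open>B G = cis (- \<theta> * x) * G x (y+1)\<close>, and
  \<open>AB = cis (-\<theta>) BA\<close>. If both nearly fix \<open>G\<close>, the phase must be
  close to 1 or \<open>G\<close> small. The margin in \<open>supp\<close> keeps all one-step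
  translates of the support inside \<open>T\<close>.\<close>

lemma uncertainty_sum:
  fixes G :: "int \<Rightarrow> int \<Rightarrow> complex" and R :: int and \<theta> :: real
  assumes supp: "\<And>x y. G x y \<noteq> 0 \<Longrightarrow> \<bar>x\<bar> < R - 1 \<and> \<bar>y\<bar> < R - 1"
  defines "T \<equiv> {-R..R} \<times> {-R..R}"
  shows "cmod (cis \<theta> - 1) * (\<Sum>(x,y)\<in>T. (cmod (G x y))\<^sup>2) \<le>
    3 * ((\<Sum>(x,y)\<in>T. (cmod (G (x+1) y - G x y))\<^sup>2) +
         (\<Sum>(x,y)\<in>T. (cmod (cis (- \<theta> * x) * G x (y+1) - G x y))\<^sup>2))"
proof -
  define w where "w = cmod (cis \<theta> - 1)"
  have w: "0 \<le> w" "w \<le> 2"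
    using norm_triangle_ineq4[of "cis \<theta>" 1] by (auto simp: w_def)
  have cmodw: "cmod (cis (-\<theta>) - 1) = w"
    unfolding w_def using complex_mod_cnj[of "cis \<theta> - 1"] by (simp add: cis_cnj)
  \<comment> \<open>A unimodular factor that rotates \<open>cis (-\<theta>) - 1\<close> onto its
    modulus, so that passing to real parts loses nothing.\<close>
  obtain v where v: "cmod v = 1" "v * (cis (-\<theta>) - 1) = of_real w"
  proof (cases "w = 0")
    case True
    then show ?thesis using that[of 1] cmodw by auto
  next
    case False
    define d where "d = cis (-\<theta>) - 1"
    have d: "cmod d = w" using cmodw by (simp add: d_def)
    have "cnj d / of_real w * d = of_real w"
      using d False complex_norm_square[of d] by (simp add: power2_eq_square field_simps)
    moreover have "cmod (cnj d / of_real w) = 1"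
      using d False w by (simp add: norm_divide)
    ultimately show ?thesis using that d_def by blast
  qed
  have finT: "finite T" by (simp add: T_def)
  have G0: "G x y = 0" if "\<bar>x\<bar> \<ge> R - 1 \<or> \<bar>y\<bar> \<ge> R - 1" for x y
    using supp[of x y] that by fastforce
  define c where "c x = cis (- \<theta> * of_int x)" for x :: int
  have c1: "cmod (c x) = 1" for x by (simp add: c_def)
  have cS: "c (x+1) = cis (-\<theta>) * c x" for x
    by (simp add: c_def cis_mult algebra_simps)
  define K where "K x y = G (x+1) y - G x y" for x y
  define H where "H x y = c x * G x (y+1) - G x y" for x y
  define \<alpha> where "\<alpha> = (\<Sum>(x,y)\<in>T. (cmod (K x y))\<^sup>2)"
  define \<beta> where "\<beta> = (\<Sum>(x,y)\<in>T. (cmod (H x y))\<^sup>2)"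
  define N where "N = (\<Sum>(x,y)\<in>T. (cmod (G x y))\<^sup>2)"
  have shift: "(\<Sum>(x,y)\<in>T. g (x + a) (y + b)) = (\<Sum>(x,y)\<in>T. g x y)"
    if "\<And>x y. g x y \<noteq> 0 \<Longrightarrow> (x,y) \<in> T" "\<And>x y. g (x + a) (y + b) \<noteq> 0 \<Longrightarrow> (x,y) \<in> T"
    for g :: "int \<Rightarrow> int \<Rightarrow> real" and a b :: int
  proof -
    have "bij (\<lambda>(x::int,y::int). (x + a, y + b))"
      by (rule bij_betw_byWitness[where f' = "\<lambda>(x,y). (x - a, y - b)"]) auto
    from sum_shift_invariant[OF finT this, of "\<lambda>(x,y). g x y"] that
    show ?thesis by (auto simp: case_prod_beta)
  qed
  have Tin: "(x,y) \<in> T" if "G x y \<noteq> 0 \<or> G (x+1) y \<noteq> 0 \<or> G x (y+1) \<noteq> 0 \<or> G (x-1) y \<noteq> 0 \<or> G x (y-1) \<noteq> 0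
     \<or> G (x+1) (y+1) \<noteq> 0" for x y
    using that G0 by (auto simp: T_def) (smt (verit, best))+
  text \<open>The commutator identity \<open>AB - BA = (A-1)(B-1) - (B-1)(A-1)\<close>. Moving the outer difference
    in each term to its adjoint on \<open>G\<close> leaves first differences only, which AM-GM controls.\<close>
  have P: "w * Re (c x * G (x+1) (y+1) * cnj (G x y)) =
      (Re (v * H (x+1) y * cnj (G x y)) - Re (v * H x y * cnj (G x y)))
    - (Re (v * (c x * K x (y+1)) * cnj (G x y)) - Re (v * K x y * cnj (G x y)))" for x y
  proof -
    have "of_real w * (c x * G (x+1) (y+1) * cnj (G x y)) =
       v * ((cis (-\<theta>) - 1) * c x * G (x+1) (y+1)) * cnj (G x y)"
      by (simp add: v(2)[symmetric] algebra_simps)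
    also have "(cis (-\<theta>) - 1) * c x * G (x+1) (y+1) = (H (x+1) y - H x y) - (c x * K x (y+1) - K x y)"
      unfolding H_def K_def cS by (simp add: algebra_simps)
    finally have "of_real w * (c x * G (x+1) (y+1) * cnj (G x y)) =
      (v * H (x+1) y * cnj (G x y) - v * H x y * cnj (G x y))
     - (v * (c x * K x (y+1)) * cnj (G x y) - v * K x y * cnj (G x y))"
      by (simp add: algebra_simps)
    from arg_cong[OF this, of Re] show ?thesis by simp
  qed
  have s1: "(\<Sum>(x,y)\<in>T. Re (v * H (x+1) y * cnj (G x y)) - Re (v * H x y * cnj (G x y))) \<le> (\<alpha> + \<beta>) / 2"
  proof -
    have "(\<Sum>(x,y)\<in>T. Re (v * H (x+1) y * cnj (G x y))) = (\<Sum>(x,y)\<in>T. Re (v * H x y * cnj (G (x-1) y)))"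
      by (rule trans[OF _ shift[of "\<lambda>x y. Re (v * H x y * cnj (G (x-1) y))" 1 0]], simp) (rule Tin, auto simp: K_def H_def)+
    then have "(\<Sum>(x,y)\<in>T. Re (v * H (x+1) y * cnj (G x y)) - Re (v * H x y * cnj (G x y)))
       = (\<Sum>(x,y)\<in>T. Re ((v * H x y) * cnj (G (x-1) y - G x y)))"
      by (simp only: case_prod_unfold sum_subtractf complex_cnj_diff right_diff_distrib minus_complex.simps)
    also have "\<dots> \<le> (\<Sum>(x,y)\<in>T. ((cmod (H x y))\<^sup>2 + (cmod (G (x-1) y - G x y))\<^sup>2) / 2)"
      by (rule sum_mono) (simp only: case_prod_unfold Re_mult_cnj_le[OF v(1)])
    also have "\<dots> = (\<beta> + (\<Sum>(x,y)\<in>T. (cmod (G (x-1) y - G x y))\<^sup>2)) / 2"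
      by (simp add: \<beta>_def case_prod_unfold sum.distrib sum_divide_distrib[symmetric])
    also have "(\<Sum>(x,y)\<in>T. (cmod (G (x-1) y - G x y))\<^sup>2) = \<alpha>"
      unfolding \<alpha>_def
      by (rule trans[OF shift[of "\<lambda>x y. (cmod (G (x-1) y - G x y))\<^sup>2" 1 0, symmetric]])
        (rule Tin, auto simp: K_def norm_minus_commute)+
    finally show ?thesis by simp
  qed
  have s2: "- (\<Sum>(x,y)\<in>T. Re (v * (c x * K x (y+1)) * cnj (G x y)) - Re (v * K x y * cnj (G x y))) \<le> (\<alpha> + \<beta>) / 2"
  proof -
    have "(\<Sum>(x,y)\<in>T. Re (v * (c x * K x (y+1)) * cnj (G x y))) = (\<Sum>(x,y)\<in>T. Re (v * (c x * K x y) * cnj (G x (y-1))))"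
      by (rule trans[OF _ shift[of "\<lambda>x y. Re (v * (c x * K x y) * cnj (G x (y-1)))" 0 1]], simp) (rule Tin, auto simp: K_def H_def)+
    moreover have "Re (v * K x y * cnj (G x y - cnj (c x) * G x (y-1))) =
        Re (v * K x y * cnj (G x y)) - Re (v * (c x * K x y) * cnj (G x (y-1)))" for x y
    proof -
      have "v * K x y * cnj (G x y - cnj (c x) * G x (y-1)) =
          v * K x y * cnj (G x y) - v * (c x * K x y) * cnj (G x (y-1))"
        by (simp add: algebra_simps)
      then show ?thesis by (simp only: minus_complex.simps)
    qed
    ultimately have "- (\<Sum>(x,y)\<in>T. Re (v * (c x * K x (y+1)) * cnj (G x y)) - Re (v * K x y * cnj (G x y)))
       = (\<Sum>(x,y)\<in>T. Re (v * K x y * cnj (G x y - cnj (c x) * G x (y-1))))"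
      by (simp only: case_prod_unfold sum_subtractf)
    also have "\<dots> \<le> (\<Sum>(x,y)\<in>T. ((cmod (K x y))\<^sup>2 + (cmod (G x y - cnj (c x) * G x (y-1)))\<^sup>2) / 2)"
      by (rule sum_mono) (simp only: case_prod_unfold Re_mult_cnj_le[OF v(1)])
    also have "\<dots> = (\<alpha> + (\<Sum>(x,y)\<in>T. (cmod (G x y - cnj (c x) * G x (y-1)))\<^sup>2)) / 2"
      by (simp add: \<alpha>_def case_prod_unfold sum.distrib sum_divide_distrib[symmetric])
    \<comment> \<open>Multiplying by the unimodular \<open>c x\<close> keeps the modulus and
      produces \<open>H x (y-1)\<close>, so one more shift in \<open>y\<close> gives
      \<open>\<beta>\<close>.\<close>
    also have "(\<Sum>(x,y)\<in>T. (cmod (G x y - cnj (c x) * G x (y-1)))\<^sup>2) = (\<Sum>(x,y)\<in>T. (cmod (c x * G x y - G x (y-1)))\<^sup>2)"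
    proof (rule sum.cong; clarify)
      fix x y
      show "(cmod (G x y - cnj (c x) * G x (y-1)))\<^sup>2 = (cmod (c x * G x y - G x (y-1)))\<^sup>2"
      proof -
        have "c x * (G x y - cnj (c x) * G x (y-1)) = c x * G x y - G x (y-1)"
          using complex_norm_square[of "c x"] c1[of x] by (simp add: algebra_simps)
        then show ?thesis by (metis c1 norm_mult mult_1)
      qed
    qed
    also have "(\<Sum>(x,y)\<in>T. (cmod (c x * G x y - G x (y-1)))\<^sup>2) = \<beta>"
      unfolding \<beta>_def
      by (rule trans[OF shift[of "\<lambda>x y. (cmod (c x * G x y - G x (y-1)))\<^sup>2" 0 1, symmetric]])
        (rule Tin, auto simp: H_def)+
    finally show ?thesis by simp
  qed
  have up: "w * (\<Sum>(x,y)\<in>T. Re (c x * G (x+1) (y+1) * cnj (G x y))) \<le> \<alpha> + \<beta>"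
  proof -
    have "a \<le> q / 2 \<Longrightarrow> - b \<le> q / 2 \<Longrightarrow> a - b \<le> q" for a b q :: real by linarith
    from this[OF s1[unfolded case_prod_unfold sum_subtractf] s2[unfolded case_prod_unfold sum_subtractf]]
    show ?thesis unfolding sum_distrib_left case_prod_unfold P sum_subtractf .
  qed
  \<comment> \<open>\<open>BA G - G\<close> splits into one increment of each generator, so by
    polarization the correlation of \<open>BA G\<close> with \<open>G\<close> falls short of
    \<open>N\<close> by at most \<open>\<alpha> + \<beta>\<close>.\<close>
  have low: "N - (\<alpha> + \<beta>) \<le> (\<Sum>(x,y)\<in>T. Re (c x * G (x+1) (y+1) * cnj (G x y)))"
  proof -
    have "Re (c x * G (x+1) (y+1) * cnj (G x y)) \<ge>
      ((cmod (G (x+1) (y+1)))\<^sup>2 + (cmod (G x y))\<^sup>2) / 2 - (cmod (K x (y+1)))\<^sup>2 - (cmod (H x y))\<^sup>2" for x y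
    proof -
      have "c x * G (x+1) (y+1) - G x y = c x * K x (y+1) + H x y"
        by (simp add: K_def H_def algebra_simps)
      then have "(cmod (c x * G (x+1) (y+1) - G x y))\<^sup>2 \<le> 2 * (cmod (K x (y+1)))\<^sup>2 + 2 * (cmod (H x y))\<^sup>2"
        using norm_sum_power2_le[of "c x * K x (y+1)" "H x y"] by (simp add: norm_mult c1)
      moreover have "cmod (c x * G (x+1) (y+1)) = cmod (G (x+1) (y+1))" by (simp add: norm_mult c1)
      moreover have "X \<le> 2 * a + 2 * b \<Longrightarrow> q / 2 - a - b \<le> (q - X) / 2" for X a b q :: real by (simp add: field_simps)
      ultimately show ?thesis unfolding Re_mult_cnj_ge by (simp only:)
    qed
    then have "(\<Sum>(x,y)\<in>T. ((cmod (G (x+1) (y+1)))\<^sup>2 + (cmod (G x y))\<^sup>2) / 2 - (cmod (K x (y+1)))\<^sup>2 - (cmod (H x y))\<^sup>2)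
       \<le> (\<Sum>(x,y)\<in>T. Re (c x * G (x+1) (y+1) * cnj (G x y)))"
      by (intro sum_mono) auto
    moreover have "(\<Sum>(x,y)\<in>T. (cmod (G (x+1) (y+1)))\<^sup>2) = N"
      unfolding N_def
      by (rule shift[of "\<lambda>x y. (cmod (G x y))\<^sup>2" 1 1]; rule Tin, auto)
    moreover have "(\<Sum>(x,y)\<in>T. (cmod (K x (y+1)))\<^sup>2) = \<alpha>"
      unfolding \<alpha>_def
      by (rule trans[OF _ shift[of "\<lambda>x y. (cmod (K x y))\<^sup>2" 0 1]], simp) (rule Tin, auto simp: K_def)+
    ultimately show ?thesis
      by (simp add: N_def[symmetric] \<beta>_def[symmetric] case_prod_unfold sum.distrib sum_subtractf
         sum_divide_distrib[symmetric]) (simp add: N_def \<beta>_def case_prod_unfold)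
  qed
  have nn: "0 \<le> \<alpha> + \<beta>" unfolding \<alpha>_def \<beta>_def by (intro add_nonneg_nonneg sum_nonneg) auto
  have "w * (N - (\<alpha> + \<beta>)) \<le> \<alpha> + \<beta>"
    using mult_left_mono[OF low w(1)] up by linarith
  \<comment> \<open>\<open>w \<le> 2\<close> absorbs the error term; the constant is 1 + 2 =
    3.\<close>
  moreover have "w * (\<alpha> + \<beta>) \<le> 2 * (\<alpha> + \<beta>)" using w nn by (intro mult_right_mono) auto
  ultimately have "w * N \<le> 3 * (\<alpha> + \<beta>)" by (simp add: algebra_simps)
  then show ?thesis by (simp add: w_def N_def \<alpha>_def \<beta>_def K_def H_def c_def)
qed

text \<open>With \<open>w = cmod (cis \<theta> - 1)\<close>, a summand is at most
  \<open>4^j * w^2\<close> and at most \<open>4 / 4^j\<close>. It decays geometrically away from the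
  scale where \<open>4^j\<close> is about \<open>1 / w\<close>, and there it has size
  \<open>w\<close>. The total is therefore linear in \<open>w\<close>, the quantity that
  \<open>uncertainty_sum\<close> controls.\<close>

lemma sum_dyadic_cis_le:
  "(\<Sum>j<J. (1 / 4^j) * (cmod (cis (4^j * \<theta>) - 1))\<^sup>2) \<le> 9 * cmod (cis \<theta> - 1)"
proof -
  define w where "w = cmod (cis \<theta> - 1)"
  define u where "u j = 4^j * w" for j :: nat
  \<comment> \<open>The summand \<open>w * min (4/a) a\<close> with \<open>a = 4^j w\<close> is dominated by an increment of a bounded function,
    so the sum telescopes.\<close>
  define \<phi> where "\<phi> a = a / (1 + a)" for a :: real
  have w: "0 \<le> w" by (simp add: w_def)
  have step: "(1 / 4^j) * (cmod (cis (4^j * \<theta>) - 1))\<^sup>2 \<le> 9 * w * (\<phi> (u (Suc j)) - \<phi> (u j))" for j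
  proof -
    define m where "m = cmod (cis (4^j * \<theta>) - 1)"
    define a where "a = u j"
    have a0: "0 \<le> a" using w by (simp add: a_def u_def)
    have m0: "0 \<le> m" by (simp add: m_def)
    have m2: "m \<le> 2"
      using norm_triangle_ineq4[of "cis (4^j * \<theta>)" 1] by (simp add: m_def)
    have "cis (4^j * \<theta>) = cis \<theta> ^ (4^j)" by (simp add: Complex.DeMoivre)
    then have ma: "m \<le> a"
      using norm_power_diff[of "cis \<theta>" 1 "4^j"] by (simp add: m_def a_def u_def w_def)
    \<comment> \<open>The bounds \<open>m \<le> a\<close> and \<open>m \<le> 2\<close> cross at
      \<open>a = 2\<close>, where \<open>(1 + a) * (1 + 4 * a)\<close> equals 27. The increment of
      \<open>\<phi>\<close> has numerator \<open>3 * a\<close>, which leaves the factor 27 / 3 =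
      9.\<close>
    have key: "m\<^sup>2 * ((1 + a) * (1 + 4 * a)) \<le> 27 * a\<^sup>2"
    proof (cases "a \<le> 2")
      case True
      have "(1 + a) * (1 + 4 * a) \<le> 3 * 9" using a0 True by (intro mult_mono) auto
      moreover have "m\<^sup>2 \<le> a\<^sup>2" using ma m0 by (intro power_mono) auto
      ultimately show ?thesis
        using mult_mono[of "m\<^sup>2" "a\<^sup>2" "(1 + a) * (1 + 4 * a)" 27] a0 by (simp add: algebra_simps)
    next
      case False
      have "m\<^sup>2 \<le> 2\<^sup>2" using m2 m0 by (intro power_mono) auto
      then have "m\<^sup>2 * ((1 + a) * (1 + 4 * a)) \<le> 4 * ((1 + a) * (1 + 4 * a))"
        using a0 by (intro mult_right_mono) auto
      also have "\<dots> = 16 * a\<^sup>2 + 20 * a + 4" by (simp add: power2_eq_square algebra_simps)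
      also have "\<dots> \<le> 27 * a\<^sup>2"
      proof -
        have "2 * a \<le> a * a" using False by (intro mult_right_mono) auto
        then show ?thesis using False unfolding power2_eq_square by linarith
      qed
      finally show ?thesis .
    qed
    have "\<phi> (u (Suc j)) - \<phi> (u j) = 3 * a / ((1 + a) * (1 + 4 * a))"
    proof -
      have "\<phi> (u (Suc j)) - \<phi> (u j) = 4 * a / (1 + 4 * a) - a / (1 + a)"
        by (simp add: \<phi>_def a_def u_def mult.assoc)
      also have "\<dots> = 3 * a / ((1 + a) * (1 + 4 * a))"
      proof -
        have "1 + 4 * a \<noteq> 0" "1 + a \<noteq> 0" using a0 by auto
        then show ?thesis by (simp add: diff_frac_eq) (simp add: algebra_simps)
      qed
      finally show ?thesis .
    qed
    moreover have "m\<^sup>2 \<le> 4^j * (9 * w * (3 * a / ((1 + a) * (1 + 4 * a))))"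
    proof -
      have "4^j * (9 * w * (3 * a / ((1 + a) * (1 + 4 * a)))) = 27 * a\<^sup>2 / ((1 + a) * (1 + 4 * a))"
      proof -
        have "4^j * (9 * w * (3 * a / ((1 + a) * (1 + 4 * a)))) = 27 * (4^j * w) * a / ((1 + a) * (1 + 4 * a))"
          by simp
        also have "4^j * w = a" by (simp add: a_def u_def)
        finally show ?thesis by (simp add: power2_eq_square)
      qed
      moreover have "0 < (1 + a) * (1 + 4 * a)" using a0 by (intro mult_pos_pos) auto
      moreover from this key have "m\<^sup>2 \<le> 27 * a\<^sup>2 / ((1 + a) * (1 + 4 * a))" by (simp add: le_divide_eq)
      ultimately show ?thesis by (simp only:)
    qed
    ultimately show ?thesis unfolding m_def[symmetric] by (simp add: field_simps)
  qed
  have "(\<Sum>j<J. (1 / 4^j) * (cmod (cis (4^j * \<theta>) - 1))\<^sup>2) \<le> (\<Sum>j<J. 9 * w * (\<phi> (u (Suc j)) - \<phi> (u j)))"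
    by (intro sum_mono step)
  also have "\<dots> = 9 * w * (\<phi> (u J) - \<phi> (u 0))"
    by (simp add: sum_distrib_left[symmetric] sum_lessThan_telescope[of "\<lambda>j. \<phi> (u j)"])
  also have "\<dots> \<le> 9 * w * 1"
  proof -
    have "0 \<le> u j" for j using w by (simp add: u_def)
    then have "\<phi> (u J) \<le> 1" "0 \<le> \<phi> (u 0)" by (auto simp: \<phi>_def divide_simps) (smt (verit))+
    then show ?thesis using w by (intro mult_left_mono) auto
  qed
  finally show ?thesis by (simp add: w_def)
qed

text \<open>\<open>M\<close> is the number of points of \<open>{-R..R}\<close>, so distinct points
  stay distinct modulo \<open>M\<close> and the characters are orthogonal: the geometric sum of an
  \<open>M\<close>-th root of unity other than 1 vanishes.\<close>

lemma parseval_dft: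
  fixes f :: "int \<Rightarrow> complex" and R :: int
  assumes "0 \<le> R"
  defines "M \<equiv> nat (2 * R + 1)"
  shows "(\<Sum>l<M. (cmod (\<Sum>z=-R..R. f z * cis (- (2 * pi * real l / M) * z)))\<^sup>2) = M * (\<Sum>z=-R..R. (cmod (f z))\<^sup>2)"
proof -
  have M: "M > 0" "int M = 2 * R + 1" using assms by (auto simp: M_def)
  have orth: "(\<Sum>l<M. cis (2 * pi * l / M * (z' - z))) = (if z = z' then of_nat M else 0)"
    if "z \<in> {-R..R}" "z' \<in> {-R..R}" for z z' :: int
  proof (cases "z = z'")
    case False
    define \<zeta> where "\<zeta> = cis (2 * pi * (z' - z) / M)"
    have "cis (2 * pi * l / M * (z' - z)) = \<zeta> ^ l" for l :: nat
      unfolding \<zeta>_def Complex.DeMoivre by (rule arg_cong[of _ _ cis]) (simp add: field_simps)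
    moreover have "\<zeta> ^ M = 1"
    proof -
      have "\<zeta> ^ M = cis (2 * pi * (z' - z))" 
        unfolding \<zeta>_def Complex.DeMoivre using M by (intro arg_cong[of _ _ cis]) simp
      also have "\<dots> = 1" by (metis cis_multiple_2pi Ints_of_int of_int_diff)
      finally show ?thesis .
    qed
    moreover have "\<zeta> \<noteq> 1"
    proof
      assume "\<zeta> = 1"
      then have "cos (2 * pi * (z' - z) / M) = 1" by (simp add: \<zeta>_def complex_eq_iff)
      then obtain k :: int where k: "2 * pi * (z' - z) / M = of_int k * 2 * pi"
        by (auto simp: cos_one_2pi_int)
      then have "2 * pi * (z' - z) = 2 * pi * (k * int M)"
        using M(1) by (simp add: field_simps)
      then have "real_of_int (z' - z) = of_int (k * int M)" by simp
      then have e: "z' - z = k * int M" by linarith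
      then have "int M dvd (z' - z)" by simp
      moreover have "\<bar>z' - z\<bar> < int M" using that M by auto
      ultimately show False using False dvd_imp_le_int[of "z' - z" "int M"] by auto
    qed
    ultimately show ?thesis using False by (simp add: geometric_sum)
  qed simp
  have "of_real (\<Sum>l<M. (cmod (\<Sum>z=-R..R. f z * cis (- (2 * pi * l / M) * z)))\<^sup>2)
     = (\<Sum>l<M. \<Sum>z=-R..R. \<Sum>z'=-R..R. f z * cnj (f z') * cis (2 * pi * l / M * (z' - z)))"
    unfolding of_real_sum
  proof (intro sum.cong refl)
    fix l :: nat
    define e where "e z = cis (- (2 * pi * l / M) * of_int z)" for z :: int
    have e: "e z * cnj (e z') = cis (2 * pi * l / M * (z' - z))" for z z'
      unfolding e_def cis_cnj cis_mult by (rule arg_cong[of _ _ cis]) (simp add: algebra_simps diff_divide_distrib)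
    have "complex_of_real ((cmod (\<Sum>z=-R..R. f z * e z))\<^sup>2) =
        (\<Sum>z=-R..R. \<Sum>z'=-R..R. f z * cnj (f z') * (e z * cnj (e z')))"
      unfolding complex_norm_square by (simp add: sum_product mult_ac)
    then show "complex_of_real ((cmod (\<Sum>z=-R..R. f z * cis (- (2 * pi * l / M) * of_int z)))\<^sup>2) =
        (\<Sum>z=-R..R. \<Sum>z'=-R..R. f z * cnj (f z') * cis (2 * pi * l / M * (z' - z)))"
      by (simp only: e) (simp only: e_def)
  qed
  also have "\<dots> = (\<Sum>z=-R..R. \<Sum>z'=-R..R. f z * cnj (f z') * (\<Sum>l<M. cis (2 * pi * l / M * (z' - z))))"
    by (simp only: sum_distrib_left) (subst sum.swap, intro sum.cong refl, rule sum.swap)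
  also have "\<dots> = (\<Sum>z=-R..R. \<Sum>z'=-R..R. f z * cnj (f z') * (if z = z' then of_nat M else 0))"
    using orth by (intro sum.cong refl) simp
  also have "\<dots> = (\<Sum>z=-R..R. of_nat M * (f z * cnj (f z)))"
    by (intro sum.cong refl) (simp add: if_distrib sum.delta cong: if_cong)
  also have "\<dots> = of_real (M * (\<Sum>z=-R..R. (cmod (f z))\<^sup>2))"
    unfolding of_real_mult of_real_sum complex_norm_square by (simp add: sum_distrib_left)
  finally show ?thesis by (simp only: of_real_eq_iff)
qed

text \<open>Parseval in \<open>z\<close> turns vertical differences into multipliers
  \<open>cis (4^j * \<theta>) - 1\<close>, whose weighted squares sum to at most
  \<open>9 * cmod (cis \<theta> - 1)\<close>; \<open>uncertainty_sum\<close> at each frequency then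
  gives 27 = 9 * 3. The bound on \<open>R\<close> keeps every shifted support inside
  \<open>T\<close>.\<close>

lemma vertical_le_horizontal_sum:
  fixes F :: "int \<Rightarrow> int \<Rightarrow> int \<Rightarrow> real" and r R :: int and J :: nat
  assumes supp: "\<And>x y z. F x y z \<noteq> 0 \<Longrightarrow> \<bar>x\<bar> \<le> r \<and> \<bar>y\<bar> \<le> r \<and> \<bar>z\<bar> \<le> r"
    and r: "0 \<le> r" and R: "2 * r + 4 ^ J + 1 \<le> R"
  defines "T \<equiv> {-R..R}"
  shows "(\<Sum>(x,y)\<in>T\<times>T. \<Sum>z\<in>T. \<Sum>j<J. (1 / 4^j) * (F x y (z + 4^j) - F x y z)\<^sup>2) \<le>
    27 * (\<Sum>(x,y)\<in>T\<times>T. \<Sum>z\<in>T. (F (x+1) y z - F x y z)\<^sup>2 + (F x (y+1) (z - x) - F x y z)\<^sup>2)"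
proof -
  define M where "M = nat (2 * R + 1)"
  have J1: "(1::int) \<le> 4 ^ J" by simp
  have rR: "r < R - 1" using R r J1 by linarith
  have R0: "0 \<le> R" using R r J1 by linarith
  then have M: "M > 0" by (simp add: M_def)
  define \<theta> where "\<theta> l = 2 * pi * l / M" for l :: nat
  define e where "e l z = cis (- \<theta> l * of_int z)" for l and z :: int
  define hat where "hat l x y = (\<Sum>z\<in>T. of_real (F x y z) * e l z)" for l x y
  have pars: "(\<Sum>z\<in>T. (f z)\<^sup>2) = (\<Sum>l<M. (cmod (\<Sum>z\<in>T. of_real (f z) * e l z))\<^sup>2) / M"
    for f :: "int \<Rightarrow> real"
    using parseval_dft[OF R0, of "\<lambda>z. of_real (f z)"] M
    by (simp add: T_def e_def \<theta>_def M_def[symmetric])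
  have F0: "F x y z = 0" if "\<bar>x\<bar> > r \<or> \<bar>y\<bar> > r \<or> \<bar>z\<bar> > r" for x y z
    using supp[of x y z] that by fastforce
  \<comment> \<open>The bound on \<open>k\<close> is conditional because \<open>k = - x\<close> is
    used for the second generator; when \<open>\<bar>x\<bar> > r\<close> both sides vanish.\<close>
  have shift: "(\<Sum>z\<in>T. of_real (F x y (z + k)) * e l z) = cis (\<theta> l * k) * hat l x y"
    if "\<bar>x\<bar> \<le> r \<Longrightarrow> \<bar>k\<bar> \<le> r + 4^J" for x y k l
  proof (cases "\<bar>x\<bar> \<le> r")
    case True
    have b: "bij (\<lambda>z::int. z + k)" by (rule bij_betw_byWitness[where f' = "\<lambda>z. z - k"]) auto
    have e: "e l z = cis (\<theta> l * k) * e l (z + k)" for z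
      unfolding e_def cis_mult by (rule arg_cong[of _ _ cis]) (simp add: algebra_simps)
    have "of_real (F x y (z + k)) * e l z = cis (\<theta> l * k) * (of_real (F x y (z + k)) * e l (z + k))" for z
      unfolding e[of z] by (simp only: mult_ac)
    then have "(\<Sum>z\<in>T. of_real (F x y (z + k)) * e l z) =
        (\<Sum>z\<in>T. cis (\<theta> l * k) * (of_real (F x y (z + k)) * e l (z + k)))"
      by (simp only:)
    also have "\<dots> = (\<Sum>z\<in>T. cis (\<theta> l * k) * (of_real (F x y z) * e l z))"
    proof (rule sum_shift_invariant[OF _ b, of T "\<lambda>z. cis (\<theta> l * k) * (of_real (F x y z) * e l z)"])
      fix z assume "cis (\<theta> l * k) * (of_real (F x y z) * e l z) \<noteq> 0"
      then have "F x y z \<noteq> 0" by auto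
      from supp[OF this] have "\<bar>z\<bar> \<le> r" by simp
      then show "z \<in> T" using rR by (auto simp: T_def)
    next
      fix z assume "cis (\<theta> l * k) * (of_real (F x y (z+k)) * e l (z+k)) \<noteq> 0"
      then have "F x y (z+k) \<noteq> 0" by auto
      from supp[OF this] have "\<bar>z + k\<bar> \<le> r" by simp
      then show "z \<in> T" using R that[OF True] by (auto simp: T_def)
    qed (simp add: T_def)
    finally show ?thesis by (simp add: hat_def sum_distrib_left)
  next
    case False
    then show ?thesis using F0 by (simp add: hat_def)
  qed
  have hat_supp: "\<bar>x\<bar> < R - 1 \<and> \<bar>y\<bar> < R - 1" if "hat l x y \<noteq> 0" for l x y
  proof -
    obtain z where "F x y z \<noteq> 0" using \<open>hat l x y \<noteq> 0\<close> unfolding hat_def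
      by (metis (mono_tags, lifting) mult_eq_0_iff of_real_0 sum.not_neutral_contains_not_neutral)
    from supp[OF this] show ?thesis using rR by auto
  qed
  have V: "(\<Sum>z\<in>T. \<Sum>j<J. (1 / 4^j) * (F x y (z + 4^j) - F x y z)\<^sup>2) \<le>
      (\<Sum>l<M. 9 * cmod (cis (\<theta> l) - 1) * (cmod (hat l x y))\<^sup>2) / M" for x y
  proof -
    have "(\<Sum>z\<in>T. (F x y (z + 4^j) - F x y z)\<^sup>2) =
        (\<Sum>l<M. (cmod (cis (4^j * \<theta> l) - 1))\<^sup>2 * (cmod (hat l x y))\<^sup>2) / M" if "j < J" for j
    proof -
      have k: "\<bar>4 ^ j :: int\<bar> \<le> r + 4^J"
      proof -
        have "(4::int) ^ j \<le> 4 ^ J" using that by (intro power_increasing) auto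
        moreover have "\<bar>4 ^ j :: int\<bar> = 4 ^ j" by simp
        ultimately show ?thesis using r by linarith
      qed
      have "(\<Sum>z\<in>T. of_real (F x y (z + 4^j) - F x y z) * e l z) = (cis (4^j * \<theta> l) - 1) * hat l x y" for l
        using shift[of x "4^j" y l] k by (simp add: hat_def sum_subtractf algebra_simps)
      then show ?thesis unfolding pars by (simp add: norm_mult power_mult_distrib)
    qed
    then have "(\<Sum>z\<in>T. \<Sum>j<J. (1 / 4^j) * (F x y (z + 4^j) - F x y z)\<^sup>2) =
       (\<Sum>j<J. (1 / 4^j) * ((\<Sum>l<M. (cmod (cis (4^j * \<theta> l) - 1))\<^sup>2 * (cmod (hat l x y))\<^sup>2) / M))"
      by (subst sum.swap, intro sum.cong refl) (simp only: sum_distrib_left[symmetric] lessThan_iff)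
    also have "\<dots> = (\<Sum>j<J. \<Sum>l<M. (1 / 4^j) * (cmod (cis (4^j * \<theta> l) - 1))\<^sup>2 * (cmod (hat l x y))\<^sup>2 / M)"
      unfolding sum_distrib_left sum_divide_distrib by (simp only: mult.assoc times_divide_eq_right)
    also have "\<dots> = (\<Sum>l<M. (\<Sum>j<J. (1 / 4^j) * (cmod (cis (4^j * \<theta> l) - 1))\<^sup>2) * (cmod (hat l x y))\<^sup>2) / M"
      by (subst sum.swap) (simp only: sum_distrib_right sum_divide_distrib)
    also have "\<dots> \<le> (\<Sum>l<M. 9 * cmod (cis (\<theta> l) - 1) * (cmod (hat l x y))\<^sup>2) / M"
      by (intro divide_right_mono sum_mono mult_right_mono sum_dyadic_cis_le) auto
    finally show ?thesis .
  qed
  have Hx: "(\<Sum>z\<in>T. (F (x+1) y z - F x y z)\<^sup>2) = (\<Sum>l<M. (cmod (hat l (x+1) y - hat l x y))\<^sup>2) / M" for x y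
    unfolding pars by (simp add: hat_def sum_subtractf algebra_simps)
  have Hy: "(\<Sum>z\<in>T. (F x (y+1) (z - x) - F x y z)\<^sup>2) =
      (\<Sum>l<M. (cmod (cis (- \<theta> l * x) * hat l x (y+1) - hat l x y))\<^sup>2) / M" for x y
  proof -
    have "\<bar>- x\<bar> \<le> r + 4 ^ J" if "\<bar>x\<bar> \<le> r" using that J1 by linarith
    from shift[of x "- x", OF this] show ?thesis
      unfolding pars by (simp add: hat_def sum_subtractf left_diff_distrib)
  qed
  have "(\<Sum>(x,y)\<in>T\<times>T. \<Sum>z\<in>T. \<Sum>j<J. (1 / 4^j) * (F x y (z + 4^j) - F x y z)\<^sup>2)
     \<le> (\<Sum>(x,y)\<in>T\<times>T. (\<Sum>l<M. 9 * cmod (cis (\<theta> l) - 1) * (cmod (hat l x y))\<^sup>2) / M)"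
    by (rule sum_mono) (simp only: case_prod_unfold V)
  also have "\<dots> = (\<Sum>l<M. 9 * (cmod (cis (\<theta> l) - 1) * (\<Sum>(x,y)\<in>T\<times>T. (cmod (hat l x y))\<^sup>2))) / M"
    unfolding case_prod_unfold sum_divide_distrib sum_distrib_left by (subst sum.swap) (simp only: mult.assoc)
  also have "\<dots> \<le> (\<Sum>l<M. 9 * (3 * ((\<Sum>(x,y)\<in>T\<times>T. (cmod (hat l (x+1) y - hat l x y))\<^sup>2) +
         (\<Sum>(x,y)\<in>T\<times>T. (cmod (cis (- \<theta> l * x) * hat l x (y+1) - hat l x y))\<^sup>2)))) / M"
    unfolding T_def
    by (intro divide_right_mono sum_mono mult_left_mono uncertainty_sum hat_supp) auto
  also have "\<dots> = 27 * (\<Sum>(x,y)\<in>T\<times>T. (\<Sum>l<M. (cmod (hat l (x+1) y - hat l x y))\<^sup>2) / M +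
         (\<Sum>l<M. (cmod (cis (- \<theta> l * x) * hat l x (y+1) - hat l x y))\<^sup>2) / M)"
    unfolding case_prod_unfold sum_divide_distrib sum_distrib_left sum.distrib[symmetric]
    by (subst sum.swap) (simp add: add_divide_distrib)
  also have "\<dots> = 27 * (\<Sum>(x,y)\<in>T\<times>T. \<Sum>z\<in>T. (F (x+1) y z - F x y z)\<^sup>2 + (F x (y+1) (z - x) - F x y z)\<^sup>2)"
    by (simp only: sum.distrib Hx Hy)
  finally show ?thesis .
qed

section \<open>Functions with values in the sequence space\<close>

lemma sums_ell2_norm_power2:
  assumes "a \<in> ell2"
  shows "(\<lambda>k. (a k)\<^sup>2) sums (ell2_norm a)\<^sup>2"
proof -
  have s: "summable (\<lambda>k. (a k)\<^sup>2)" using assms by (simp add: ell2_def)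
  then have "(ell2_norm a)\<^sup>2 = (\<Sum>k. (a k)\<^sup>2)"
    by (simp add: ell2_norm_def suminf_nonneg)
  with s show ?thesis by (simp add: summable_sums)
qed

text \<open>Summing the coordinatewise bound for the square of a sum gives membership and a squared
  triangle inequality at once.\<close>

lemma ell2_lincomb:
  assumes a: "a \<in> ell2" and b: "b \<in> ell2"
  shows "(\<lambda>k. s * a k + t * b k) \<in> ell2"
    and "(ell2_norm (\<lambda>k. s * a k + t * b k))\<^sup>2 \<le> 2 * s\<^sup>2 * (ell2_norm a)\<^sup>2 + 2 * t\<^sup>2 * (ell2_norm b)\<^sup>2"
proof -
  have S: "(\<lambda>k. 2 * s\<^sup>2 * (a k)\<^sup>2 + 2 * t\<^sup>2 * (b k)\<^sup>2) sums
      (2 * s\<^sup>2 * (ell2_norm a)\<^sup>2 + 2 * t\<^sup>2 * (ell2_norm b)\<^sup>2)"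
    by (intro sums_add sums_mult sums_ell2_norm_power2 a b)
  have le: "(s * a k + t * b k)\<^sup>2 \<le> 2 * s\<^sup>2 * (a k)\<^sup>2 + 2 * t\<^sup>2 * (b k)\<^sup>2" for k
    using norm_sum_power2_le[of "s * a k" "t * b k"] by (simp add: power_mult_distrib)
  show m: "(\<lambda>k. s * a k + t * b k) \<in> ell2"
    unfolding ell2_def mem_Collect_eq
    by (rule summable_comparison_test'[OF sums_summable[OF S], of 0]) (simp add: le)
  show "(ell2_norm (\<lambda>k. s * a k + t * b k))\<^sup>2 \<le> 2 * s\<^sup>2 * (ell2_norm a)\<^sup>2 + 2 * t\<^sup>2 * (ell2_norm b)\<^sup>2"
    by (rule sums_le[OF le sums_ell2_norm_power2[OF m] S])
qed

lemma ell2_diff: "a \<in> ell2 \<Longrightarrow> b \<in> ell2 \<Longrightarrow> (\<lambda>k. a k - b k) \<in> ell2"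
  using ell2_lincomb(1)[of a b 1 "-1"] by simp

text \<open>Squared norms are sums over coordinates and the lattice sums are finite, so the scalar
  inequality holds in each coordinate \<open>k\<close> and can be summed over
  \<open>k\<close>.\<close>

lemma vertical_le_horizontal_sum_ell2:
  fixes F :: "int \<Rightarrow> int \<Rightarrow> int \<Rightarrow> nat \<Rightarrow> real" and r R :: int and J :: nat
  assumes ell2: "\<And>x y z. F x y z \<in> ell2"
    and supp: "\<And>x y z k. F x y z k \<noteq> 0 \<Longrightarrow> \<bar>x\<bar> \<le> r \<and> \<bar>y\<bar> \<le> r \<and> \<bar>z\<bar> \<le> r"
    and r: "0 \<le> r" and R: "2 * r + 4 ^ J + 1 \<le> R"
  defines "T \<equiv> {-R..R}"
  shows "(\<Sum>(x,y)\<in>T\<times>T. \<Sum>z\<in>T. \<Sum>j<J. (1 / 4^j) * (ell2_norm (\<lambda>k. F x y (z + 4^j) k - F x y z k))\<^sup>2) \<le>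
    27 * (\<Sum>(x,y)\<in>T\<times>T. \<Sum>z\<in>T. (ell2_norm (\<lambda>k. F (x+1) y z k - F x y z k))\<^sup>2
      + (ell2_norm (\<lambda>k. F x (y+1) (z - x) k - F x y z k))\<^sup>2)"
proof (rule sums_le)
  show "(\<Sum>(x,y)\<in>T\<times>T. \<Sum>z\<in>T. \<Sum>j<J. (1 / 4^j) * (F x y (z + 4^j) k - F x y z k)\<^sup>2) \<le>
    27 * (\<Sum>(x,y)\<in>T\<times>T. \<Sum>z\<in>T. (F (x+1) y z k - F x y z k)\<^sup>2 + (F x (y+1) (z - x) k - F x y z k)\<^sup>2)"
    (is "?L k \<le> ?R k") for k
    unfolding T_def by (rule vertical_le_horizontal_sum[OF supp r R])
  show "?L sums (\<Sum>(x,y)\<in>T\<times>T. \<Sum>z\<in>T. \<Sum>j<J. (1 / 4^j) * (ell2_norm (\<lambda>k. F x y (z + 4^j) k - F x y z k))\<^sup>2)"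
    unfolding case_prod_unfold by (intro sums_sum sums_mult sums_ell2_norm_power2 ell2_diff ell2)
  show "?R sums (27 * (\<Sum>(x,y)\<in>T\<times>T. \<Sum>z\<in>T. (ell2_norm (\<lambda>k. F (x+1) y z k - F x y z k))\<^sup>2
      + (ell2_norm (\<lambda>k. F x (y+1) (z - x) k - F x y z k))\<^sup>2))"
    unfolding case_prod_unfold by (intro sums_sum sums_mult sums_add sums_ell2_norm_power2 ell2_diff ell2)
qed

section \<open>The integer lattice and a Lipschitz cutoff\<close>

text \<open>The summand \<open>2xy\<close> makes right multiplication by the generator \<open>(1, 0)\<close> act on \<open>x\<close> alone.\<close>

definition heis_pt :: "int \<Rightarrow> int \<Rightarrow> int \<Rightarrow> heis" where
  "heis_pt x y z = ((\<lambda>j. if j = 1 then Complex x y else 0), real_of_int (2 * x * y + 4 * z))"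

lemma heis_pt_in: "n \<ge> 1 \<Longrightarrow> heis_pt x y z \<in> heisenberg n"
  by (auto simp: heis_pt_def heisenberg_def)

text \<open>Only coordinate 1 is occupied, so the value is the same for every
  \<open>n \<ge> 1\<close>; this makes the final constant independent of the dimension.\<close>

lemma koranyi_dist_heis_pt:
  assumes "n \<ge> 1"
  shows "koranyi_dist n (heis_pt x' y' z') (heis_pt x y z) =
    root 4 (((x' - x)\<^sup>2 + (y' - y)\<^sup>2)\<^sup>2 + (2 * x' * y' + 4 * z' - 2 * x * y - 4 * z - 2 * (y * x' - x * y'))\<^sup>2)"
proof -
  have s: "(\<Sum>j=1..n. if j = 1 then c else 0) = c" for c :: real
    using assms by (simp add: sum.delta)
  have L: "L2_set (\<lambda>j. cmod (if j = 1 then c else 0)) {1..n} = cmod c" for c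
  proof -
    have "(\<Sum>j=1..n. (cmod (if j = 1 then c else 0))\<^sup>2) = (\<Sum>j=1..n. if j = 1 then (cmod c)\<^sup>2 else 0)"
      by (intro sum.cong) auto
    then show ?thesis by (simp only: L2_set_def s) simp
  qed
  have 1: "(\<lambda>j. - (if j = 1 then Complex x y else 0) + (if j = 1 then Complex x' y' else 0)) =
     (\<lambda>j::nat. if j = 1 then Complex (x' - x) (y' - y) else 0)"
    by (auto simp: complex_eq_iff)
  have 2: "(\<Sum>j=1..n. Im (- (if j = 1 then Complex x y else 0) * cnj (if j = 1 then Complex x' y' else 0))) = x * y' - y * x'"
  proof -
    have "(\<Sum>j=1..n. Im (- (if j = 1 then Complex x y else 0) * cnj (if j = 1 then Complex x' y' else 0)))
      = (\<Sum>j=1..n. if j = 1 then real_of_int (x * y' - y * x') else 0)"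
      by (intro sum.cong) auto
    then show ?thesis by (simp only: s)
  qed
  have 3: "cmod c ^ 4 = ((Re c)\<^sup>2 + (Im c)\<^sup>2)\<^sup>2" for c
    by (simp add: cmod_power2[symmetric])
  have "heis_mult n (heis_inv (heis_pt x y z)) (heis_pt x' y' z') =
    (\<lambda>j. if j = 1 then Complex (x' - x) (y' - y) else 0,
     - real_of_int (2 * x * y + 4 * z) + real_of_int (2 * x' * y' + 4 * z') + 2 * real_of_int (x * y' - y * x'))"
    by (simp only: heis_pt_def heis_inv.simps heis_mult.simps 1 2)
  then show ?thesis
    by (simp only: koranyi_dist_def koranyi_norm.simps L 3) (simp add: algebra_simps)
qed

section \<open>A cutoff adapted to the anisotropic box\<close>

definition plateau :: "real \<Rightarrow> real \<Rightarrow> real" where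
  "plateau L u = max 0 (min 1 (2 - \<bar>u\<bar> / L))"

lemma plateau_range: "0 \<le> plateau L u" "plateau L u \<le> 1"
  by (auto simp: plateau_def)

lemma plateau_eq_1: "0 < L \<Longrightarrow> \<bar>u\<bar> \<le> L \<Longrightarrow> plateau L u = 1"
  by (auto simp: plateau_def min_def max_def field_simps)

lemma plateau_eq_0: "0 < L \<Longrightarrow> 2 * L \<le> \<bar>u\<bar> \<Longrightarrow> plateau L u = 0"
  by (auto simp: plateau_def min_def max_def field_simps)

lemma plateau_lipschitz:
  assumes "0 < L"
  shows "\<bar>plateau L u - plateau L v\<bar> \<le> \<bar>u - v\<bar> / L"
proof -
  have "\<bar>plateau L u - plateau L v\<bar> \<le> \<bar>\<bar>u\<bar> / L - \<bar>v\<bar> / L\<bar>"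
    by (auto simp: plateau_def min_def max_def abs_minus_commute)
  also have "\<dots> = \<bar>\<bar>u\<bar> - \<bar>v\<bar>\<bar> / L" using assms by (simp add: diff_divide_distrib[symmetric] abs_divide)
  also have "\<dots> \<le> \<bar>u - v\<bar> / L" using assms by (intro divide_right_mono) auto
  finally show ?thesis .
qed

text \<open>The height is \<open>N\<^sup>2\<close> because the center scales quadratically: the box
  is comparable to a Koranyi ball of radius about \<open>N\<close>.\<close>

definition box_cutoff :: "int \<Rightarrow> int \<Rightarrow> int \<Rightarrow> int \<Rightarrow> real" where
  "box_cutoff N x y z = plateau N x * plateau N y * plateau (N\<^sup>2) z"

lemma box_cutoff_range: "0 \<le> box_cutoff N x y z" "box_cutoff N x y z \<le> 1"
  unfolding box_cutoff_def
  by (intro mult_nonneg_nonneg mult_le_one plateau_range)+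

lemma box_cutoff_eq_1:
  assumes "0 < N" "\<bar>x\<bar> \<le> N" "\<bar>y\<bar> \<le> N" "\<bar>z\<bar> \<le> N\<^sup>2"
  shows "box_cutoff N x y z = 1"
proof -
  have "\<bar>real_of_int z\<bar> \<le> (real_of_int N)\<^sup>2" using assms(4) by (metis of_int_abs of_int_le_iff of_int_power)
  then show ?thesis using assms by (simp add: box_cutoff_def plateau_eq_1)
qed

lemma box_cutoff_nonzeroD:
  assumes "0 < N" "box_cutoff N x y z \<noteq> 0"
  shows "\<bar>x\<bar> < 2 * N" "\<bar>y\<bar> < 2 * N" "\<bar>z\<bar> < 2 * N\<^sup>2"
proof -
  have N: "0 < real_of_int N" "0 < real_of_int (N\<^sup>2)" using assms by auto
  have "plateau N x \<noteq> 0" "plateau N y \<noteq> 0" "plateau (real_of_int (N\<^sup>2)) z \<noteq> 0"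
    using assms(2) by (auto simp: box_cutoff_def)
  then have "\<not> 2 * real_of_int N \<le> \<bar>real_of_int x\<bar>" "\<not> 2 * real_of_int N \<le> \<bar>real_of_int y\<bar>"
    "\<not> 2 * real_of_int (N\<^sup>2) \<le> \<bar>real_of_int z\<bar>"
    using plateau_eq_0 N by blast+
  then show "\<bar>x\<bar> < 2 * N" "\<bar>y\<bar> < 2 * N" "\<bar>z\<bar> < 2 * N\<^sup>2" by linarith+
qed

lemma box_cutoff_step_x:
  assumes "0 < N"
  shows "\<bar>box_cutoff N (x+1) y z - box_cutoff N x y z\<bar> \<le> 3 / N"
proof -
  have "\<bar>box_cutoff N (x+1) y z - box_cutoff N x y z\<bar> =
      \<bar>plateau N (x+1) - plateau N x\<bar> * (plateau N y * plateau (N\<^sup>2) z)"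
    unfolding box_cutoff_def mult.assoc left_diff_distrib[symmetric] abs_mult
    using plateau_range by simp
  also have "\<dots> \<le> (\<bar>real_of_int (x+1) - x\<bar> / N) * 1"
    using assms plateau_range by (intro mult_mono plateau_lipschitz mult_le_one mult_nonneg_nonneg) auto
  also have "\<dots> \<le> 3 / N" using assms by (simp add: divide_right_mono)
  finally show ?thesis .
qed

text \<open>The step moves \<open>z\<close> by \<open>-x\<close>. Where the cutoff is nonzero this
  is below \<open>2 * N\<close>, hence costs \<open>2 / N\<close> against the height
  \<open>N\<^sup>2\<close>; the move in \<open>y\<close> adds \<open>1 / N\<close>. For larger
  \<open>\<bar>x\<bar>\<close> both values vanish.\<close>

lemma box_cutoff_step_y:
  assumes "0 < N"
  shows "\<bar>box_cutoff N x (y+1) (z - x) - box_cutoff N x y z\<bar> \<le> 3 / N"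
proof (cases "\<bar>x\<bar> < 2 * N")
  case True
  define a b c d e where "a = plateau N x" and "b = plateau N (y+1)" and "c = plateau N y"
    and "d = plateau (real_of_int (N\<^sup>2)) (z - x)" and "e = plateau (real_of_int (N\<^sup>2)) z"
  have rng: "0 \<le> a" "a \<le> 1" "0 \<le> c" "c \<le> 1" "0 \<le> d" "d \<le> 1"
    using plateau_range by (auto simp: a_def b_def c_def d_def e_def)
  have N: "0 < real_of_int N" using assms by simp
  have 1: "\<bar>b - c\<bar> \<le> 1 / N"
    using plateau_lipschitz[OF N, of "y+1" y] by (simp add: b_def c_def)
  have 2: "\<bar>d - e\<bar> \<le> 2 / N"
  proof -
    have "\<bar>d - e\<bar> \<le> \<bar>real_of_int (z - x) - z\<bar> / real_of_int (N\<^sup>2)"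
      unfolding d_def e_def using assms by (intro plateau_lipschitz) simp
    also have "\<dots> \<le> 2 * N / real_of_int (N\<^sup>2)"
      using True by (intro divide_right_mono) auto
    also have "\<dots> = 2 / N" using N by (simp add: power2_eq_square)
    finally show ?thesis .
  qed
  have "box_cutoff N x (y+1) (z - x) - box_cutoff N x y z = a * ((b - c) * d + c * (d - e))"
    by (simp add: box_cutoff_def a_def b_def c_def d_def e_def algebra_simps)
  also have "\<bar>\<dots>\<bar> = a * \<bar>(b - c) * d + c * (d - e)\<bar>" using rng by (simp add: abs_mult)
  also have "\<dots> \<le> 1 * (\<bar>b - c\<bar> * 1 + 1 * \<bar>d - e\<bar>)"
  proof (intro mult_mono)
    have "\<bar>(b - c) * d + c * (d - e)\<bar> \<le> \<bar>b - c\<bar> * d + c * \<bar>d - e\<bar>"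
      using rng abs_triangle_ineq[of "(b - c) * d" "c * (d - e)"] by (simp add: abs_mult)
    also have "\<dots> \<le> \<bar>b - c\<bar> * 1 + 1 * \<bar>d - e\<bar>"
      using rng by (intro add_mono mult_mono) auto
    finally show "\<bar>(b - c) * d + c * (d - e)\<bar> \<le> \<bar>b - c\<bar> * 1 + 1 * \<bar>d - e\<bar>" .
  qed (use rng in auto)
  also have "\<dots> \<le> 1 / N + 2 / N" using 1 2 by simp
  also have "\<dots> = 3 / N" by (simp add: add_divide_distrib[symmetric])
  finally show ?thesis .
next
  case False
  then show ?thesis using assms box_cutoff_nonzeroD[OF assms, of x] by (metis abs_zero diff_0_right divide_nonneg_pos of_int_0_less_iff zero_le_numeral)
qed

section \<open>Koranyi distances between lattice points\<close>

lemma root4_square_square: "0 \<le> u \<Longrightarrow> root 4 ((u\<^sup>2)\<^sup>2) = u"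
  using real_root_power_cancel[of 4 u] by (simp add: power_mult[symmetric])

lemma koranyi_dist_step_x: "n \<ge> 1 \<Longrightarrow> koranyi_dist n (heis_pt (x+1) y z) (heis_pt x y z) = 1"
  by (simp add: koranyi_dist_heis_pt algebra_simps)

text \<open>The central term cancels: \<open>2 * x\<close> from the summand \<open>2xy\<close>,
  \<open>- 4 * x\<close> from the shift of \<open>z\<close>, and \<open>2 * x\<close> from the group
  product.\<close>

lemma koranyi_dist_step_y: "n \<ge> 1 \<Longrightarrow> koranyi_dist n (heis_pt x (y+1) (z-x)) (heis_pt x y z) = 1"
  by (simp add: koranyi_dist_heis_pt algebra_simps)

text \<open>The central displacement is \<open>4 * 4^j\<close>, and the Koranyi norm of a central
  element is the square root of its height.\<close>

lemma koranyi_dist_step_z: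
  assumes "n \<ge> 1"
  shows "koranyi_dist n (heis_pt x y (z + 4^j)) (heis_pt x y z) = 2 * 2^j"
proof -
  have "koranyi_dist n (heis_pt x y (z + 4^j)) (heis_pt x y z) = root 4 ((4 * 4^j)\<^sup>2)"
    using assms by (simp add: koranyi_dist_heis_pt algebra_simps)
  also have "(4 * 4^j :: real) = (2 * 2^j)\<^sup>2"
    by (simp add: power2_eq_square power_mult_distrib[symmetric])
  also have "root 4 (((2 * 2^j)\<^sup>2)\<^sup>2) = (2 * 2^j :: real)" by (rule root4_square_square) simp
  finally show ?thesis .
qed

lemma koranyi_dist_box_le:
  fixes N :: int
  assumes "n \<ge> 1" "1 \<le> N" "\<bar>x\<bar> \<le> 3 * N" "\<bar>y\<bar> \<le> 3 * N" "\<bar>z\<bar> \<le> 4 * N\<^sup>2"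
  shows "koranyi_dist n (heis_pt x y z) (heis_pt 0 0 0) \<le> 7 * N"
proof -
  have sq: "u\<^sup>2 \<le> (c * N)\<^sup>2" if "\<bar>u\<bar> \<le> c * N" for u c :: int
    using that by (metis abs_le_square_iff abs_of_nonneg abs_ge_zero order_trans)
  have x: "x\<^sup>2 \<le> 9 * N\<^sup>2" and y: "y\<^sup>2 \<le> 9 * N\<^sup>2"
    using sq[of x 3] sq[of y 3] assms by (auto simp: power_mult_distrib)
  have xy: "2 * \<bar>x * y\<bar> \<le> 18 * N\<^sup>2"
  proof -
    have "\<bar>x * y\<bar> \<le> (3 * N) * (3 * N)" unfolding abs_mult using assms by (intro mult_mono) auto
    then show ?thesis by (simp add: power2_eq_square)
  qed
  have "(x\<^sup>2 + y\<^sup>2)\<^sup>2 + (2 * x * y + 4 * z)\<^sup>2 \<le> (18 * N\<^sup>2)\<^sup>2 + (34 * N\<^sup>2)\<^sup>2"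
  proof (rule add_mono)
    show "(x\<^sup>2 + y\<^sup>2)\<^sup>2 \<le> (18 * N\<^sup>2)\<^sup>2" using x y by (intro power_mono) auto
    have "\<bar>2 * x * y + 4 * z\<bar> \<le> 34 * N\<^sup>2" using xy assms(5) by (simp add: abs_le_iff)
    then show "(2 * x * y + 4 * z)\<^sup>2 \<le> (34 * N\<^sup>2)\<^sup>2"
      by (metis abs_le_square_iff abs_of_nonneg abs_ge_zero order_trans)
  qed
  \<comment> \<open>18^2 + 34^2 = 1480 is below 7^4 = 2401.\<close>
  also have "\<dots> \<le> ((7 * N)\<^sup>2)\<^sup>2" by (simp add: power_mult_distrib)
  finally have "real_of_int ((x\<^sup>2 + y\<^sup>2)\<^sup>2 + (2 * x * y + 4 * z)\<^sup>2) \<le> real_of_int (((7 * N)\<^sup>2)\<^sup>2)"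
    by (simp only: of_int_le_iff)
  then have "root 4 ((x\<^sup>2 + y\<^sup>2)\<^sup>2 + (2 * x * y + 4 * z)\<^sup>2) \<le> root 4 (((7 * N)\<^sup>2)\<^sup>2)"
    by (simp del: of_int_le_iff)
  also have "\<dots> = 7 * N" using assms(2) root4_square_square[of "7 * N"] by simp
  finally show ?thesis using assms(1) by (simp add: koranyi_dist_heis_pt)
qed

section \<open>Distortion of the snowflake\<close>

lemma snowflake_distortion_ge:
  fixes \<epsilon> D :: real
  assumes n: "n \<ge> 1" and \<epsilon>: "0 < \<epsilon>" "\<epsilon> < 1/2" and D: "1 \<le> D"
    and f: "f \<in> heisenberg n \<rightarrow> ell2"
    and lower: "\<And>g h. g \<in> heisenberg n \<Longrightarrow> h \<in> heisenberg n \<Longrightarrow>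
      koranyi_dist n g h powr (1 - \<epsilon>) \<le> ell2_norm (\<lambda>k. f g k - f h k)"
    and upper: "\<And>g h. g \<in> heisenberg n \<Longrightarrow> h \<in> heisenberg n \<Longrightarrow>
      ell2_norm (\<lambda>k. f g k - f h k) \<le> D * koranyi_dist n g h powr (1 - \<epsilon>)"
  shows "1 / 13000 / sqrt \<epsilon> \<le> D"
proof -
  \<comment> \<open>For \<open>j < J\<close> this keeps \<open>\<epsilon> * j\<close> at most 3/2,
    so the snowflake exponent costs only a bounded factor at each scale.\<close>
  define J where "J = nat \<lceil>1 / \<epsilon>\<rceil>"
  have J: "1 / \<epsilon> \<le> J" "J < 1 / \<epsilon> + 1"
    using \<epsilon> by (auto simp: J_def of_nat_nat ceiling_correct) (linarith)+
  define N :: int where "N = 2 ^ J"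
  have N1: "1 \<le> N" by (simp add: N_def)
  have N2: "N\<^sup>2 = 4 ^ J" by (simp add: N_def power2_eq_square power_mult_distrib[symmetric])
  have NN: "N \<le> N\<^sup>2" using N1 by (simp add: power2_eq_square)
  define p where "p = heis_pt"
  have p: "p x y z \<in> heisenberg n" for x y z using n by (simp add: p_def heis_pt_in)
  \<comment> \<open>Normalized to vanish at the origin, so that \<open>upper\<close> bounds the norm
    of \<open>g\<close> by the distance to the origin.\<close>
  define g where "g x y z k = f (p x y z) k - f (p 0 0 0) k" for x y z k
  have g: "g x y z \<in> ell2" for x y z
    unfolding g_def using f p by (intro ell2_diff) auto
  define \<phi> where "\<phi> = box_cutoff N"
  define F where "F x y z k = \<phi> x y z * g x y z k" for x y z k
  have F: "F x y z \<in> ell2" for x y z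
    using ell2_lincomb(1)[OF g g, of "\<phi> x y z" x y z 0 x y z] by (simp add: F_def[abs_def])
  define r where "r = 2 * N\<^sup>2"
  \<comment> \<open>Exactly \<open>2 * r + 4 ^ J + 1\<close>, since
    \<open>4 ^ J = N\<^sup>2\<close>.\<close>
  define R where "R = 5 * N\<^sup>2 + 1"
  define T where "T = {-R..R}"
  have Fsupp: "\<bar>x\<bar> < 2 * N \<and> \<bar>y\<bar> < 2 * N \<and> \<bar>z\<bar> < 2 * N\<^sup>2" if "\<phi> x y z \<noteq> 0" for x y z
    using box_cutoff_nonzeroD[of N x y z] that N1 by (auto simp: \<phi>_def)
  have main: "(\<Sum>(x,y)\<in>T\<times>T. \<Sum>z\<in>T. \<Sum>j<J. (1 / 4^j) * (ell2_norm (\<lambda>k. F x y (z + 4^j) k - F x y z k))\<^sup>2) \<le>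
    27 * (\<Sum>(x,y)\<in>T\<times>T. \<Sum>z\<in>T. (ell2_norm (\<lambda>k. F (x+1) y z k - F x y z k))\<^sup>2
      + (ell2_norm (\<lambda>k. F x (y+1) (z - x) k - F x y z k))\<^sup>2)"
    unfolding T_def
  proof (rule vertical_le_horizontal_sum_ell2[OF F])
    fix x y z k assume "F x y z k \<noteq> 0"
    then have "\<phi> x y z \<noteq> 0" by (auto simp: F_def)
    from Fsupp[OF this] show "\<bar>x\<bar> \<le> r \<and> \<bar>y\<bar> \<le> r \<and> \<bar>z\<bar> \<le> r" using NN by (auto simp: r_def)
  qed (auto simp: r_def R_def N2)

  \<comment> \<open>Upper bound for the horizontal side\<close>
  define B where "B = ({-3*N..3*N} \<times> {-3*N..3*N}) \<times> {-4*N\<^sup>2..4*N\<^sup>2}"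
  have BD: "(ell2_norm (\<lambda>k. F x' y' z' k - F x y z k))\<^sup>2 \<le> 884 * D\<^sup>2"
    if "((x, y), z) \<in> B" "\<bar>\<phi> x' y' z' - \<phi> x y z\<bar> \<le> 3 / N" "koranyi_dist n (p x' y' z') (p x y z) = 1"
    for x y z x' y' z'
  proof -
    \<comment> \<open>Discrete product rule: the cutoff times the increment of \<open>f\<close>,
      plus the increment of the cutoff times \<open>g\<close>.\<close>
    have eq: "(\<lambda>k. F x' y' z' k - F x y z k) =
      (\<lambda>k. \<phi> x' y' z' * (f (p x' y' z') k - f (p x y z) k) + (\<phi> x' y' z' - \<phi> x y z) * g x y z k)"
      by (simp add: F_def g_def algebra_simps fun_eq_iff)
    have nn: "0 \<le> ell2_norm a" if "a \<in> ell2" for a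
      using that by (simp add: ell2_norm_def ell2_def suminf_nonneg)
    have d: "(\<lambda>k. f (p x' y' z') k - f (p x y z) k) \<in> ell2" using f p by (intro ell2_diff) auto
    have 1: "(ell2_norm (\<lambda>k. f (p x' y' z') k - f (p x y z) k))\<^sup>2 \<le> D\<^sup>2"
      using upper[OF p p, of x' y' z' x y z] that(3) nn[OF d] by (intro power_mono) auto
    have 2: "(ell2_norm (g x y z))\<^sup>2 \<le> (D * (7 * N))\<^sup>2"
    proof (rule power_mono)
      let ?d = "koranyi_dist n (p x y z) (p 0 0 0)"
      have "0 \<le> ?d" using n by (simp add: p_def koranyi_dist_heis_pt real_root_ge_zero)
      moreover have "?d \<le> 7 * N"
        unfolding p_def using that(1) n N1 by (intro koranyi_dist_box_le) (auto simp: B_def)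
      ultimately have "?d powr (1 - \<epsilon>) \<le> (7 * N) powr (1 - \<epsilon>)"
        using \<epsilon> by (intro powr_mono2) auto
      \<comment> \<open>Since \<open>7 * N \<ge> 1\<close>, the exponent can be raised to 1.\<close>
      also have "\<dots> \<le> (7 * N) powr 1" using \<epsilon> N1 by (intro powr_mono) auto
      also have "\<dots> = 7 * N" using N1 by simp
      finally have "D * ?d powr (1 - \<epsilon>) \<le> D * (7 * N)" using D by (intro mult_left_mono) auto
      then show "ell2_norm (g x y z) \<le> D * (7 * N)"
        unfolding g_def using upper[OF p p, of x y z 0 0 0] by linarith
    qed (rule nn[OF g])
    have 3: "(\<phi> x' y' z')\<^sup>2 \<le> 1"
      using box_cutoff_range[of N x' y' z'] by (simp add: \<phi>_def power_le_one)
    have 4: "(\<phi> x' y' z' - \<phi> x y z)\<^sup>2 \<le> (3 / N)\<^sup>2"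
      using that(2) by (metis abs_ge_zero power2_abs power_mono)
    have "(ell2_norm (\<lambda>k. F x' y' z' k - F x y z k))\<^sup>2 \<le>
       2 * (\<phi> x' y' z')\<^sup>2 * (ell2_norm (\<lambda>k. f (p x' y' z') k - f (p x y z) k))\<^sup>2 +
       2 * (\<phi> x' y' z' - \<phi> x y z)\<^sup>2 * (ell2_norm (g x y z))\<^sup>2"
      unfolding eq by (rule ell2_lincomb(2)[OF d g])
    also have "\<dots> \<le> 2 * 1 * D\<^sup>2 + 2 * (3 / N)\<^sup>2 * (D * (7 * N))\<^sup>2"
      using 1 2 3 4 by (intro add_mono mult_mono) auto
    \<comment> \<open>The growth \<open>7 * N\<close> of \<open>g\<close> cancels the slope
      \<open>3 / N\<close> of the cutoff: 2 + 2 * 9 * 49 = 884.\<close>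
    also have "\<dots> = 884 * D\<^sup>2" using N1 by (simp add: field_simps power2_eq_square)
    finally show ?thesis .
  qed
  define t where "t x y z = (ell2_norm (\<lambda>k. F (x+1) y z k - F x y z k))\<^sup>2
      + (ell2_norm (\<lambda>k. F x (y+1) (z - x) k - F x y z k))\<^sup>2" for x y z
  have tB: "t x y z \<le> 1768 * D\<^sup>2" if "((x, y), z) \<in> B" for x y z
  proof -
    have "(ell2_norm (\<lambda>k. F (x+1) y z k - F x y z k))\<^sup>2 \<le> 884 * D\<^sup>2"
      using that n N1 by (intro BD) (simp_all add: \<phi>_def p_def box_cutoff_step_x koranyi_dist_step_x)
    moreover have "(ell2_norm (\<lambda>k. F x (y+1) (z - x) k - F x y z k))\<^sup>2 \<le> 884 * D\<^sup>2"
      using that n N1 by (intro BD) (simp_all add: \<phi>_def p_def box_cutoff_step_y koranyi_dist_step_y)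
    ultimately show ?thesis by (simp add: t_def)
  qed
  \<comment> \<open>\<open>B\<close> contains the support and its preimages under one step:
    \<open>2 * N + 1 \<le> 3 * N\<close>, and the shift of \<open>z\<close> by \<open>-x\<close>
    adds at most \<open>2 * N \<le> 2 * N\<^sup>2\<close> to the height.\<close>
  have t0: "t x y z = 0" if "((x, y), z) \<notin> B" for x y z
  proof -
    have out: "\<not> (\<bar>x\<bar> \<le> 3 * N \<and> \<bar>y\<bar> \<le> 3 * N \<and> \<bar>z\<bar> \<le> 4 * N\<^sup>2)"
      using that by (auto simp: B_def)
    have "\<phi> x y z = 0" "\<phi> (x+1) y z = 0" "\<phi> x (y+1) (z - x) = 0"
      by (rule ccontr, drule Fsupp, use out NN N1 in linarith)+
    then show ?thesis by (simp add: t_def F_def ell2_norm_def)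
  qed
  have rhs: "(\<Sum>(x,y)\<in>T\<times>T. \<Sum>z\<in>T. t x y z) \<le> 441 * N^4 * (1768 * D\<^sup>2)"
  proof -
    have "(\<Sum>(x,y)\<in>T\<times>T. \<Sum>z\<in>T. t x y z) = (\<Sum>q\<in>(T\<times>T)\<times>T. t (fst (fst q)) (snd (fst q)) (snd q))"
      by (simp add: sum.cartesian_product case_prod_unfold)
    also have "\<dots> = (\<Sum>q\<in>B. t (fst (fst q)) (snd (fst q)) (snd q))"
    proof (rule sum.mono_neutral_right)
      show "B \<subseteq> (T\<times>T)\<times>T" using NN N1 by (auto simp: B_def T_def R_def)
    qed (auto simp: T_def t0)
    also have "\<dots> \<le> of_nat (card B) * (1768 * D\<^sup>2)"
      by (rule sum_bounded_above) (auto simp: tB)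
    also have "\<dots> \<le> 441 * N^4 * (1768 * D\<^sup>2)"
    proof (rule mult_right_mono)
      have "int (card B) = (6 * N + 1) * (6 * N + 1) * (8 * N\<^sup>2 + 1)"
        using N1 by (simp add: B_def card_cartesian_product)
      also have "\<dots> \<le> (7 * N) * (7 * N) * (9 * N\<^sup>2)"
        using N1 NN by (intro mult_mono) auto
      also have "\<dots> = 441 * N^4" by (simp add: power2_eq_square power4_eq_xxxx)
      finally have "real_of_int (int (card B)) \<le> real_of_int (441 * N^4)" by (simp only: of_int_le_iff)
      then show "real (card B) \<le> 441 * N^4" by simp
    qed simp
    finally show ?thesis .
  qed

  \<comment> \<open>Lower bound for the vertical side\<close>
  define s where "s x y z = (\<Sum>j<J. (1 / 4^j) * (ell2_norm (\<lambda>k. F x y (z + 4^j) k - F x y z k))\<^sup>2)" for x y z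
  \<comment> \<open>Starting at nonpositive \<open>z\<close>, a vertical step of at most
    \<open>N\<^sup>2\<close> stays where the cutoff is 1. The set has exactly \<open>N^4\<close>
    points, the order of the size of \<open>B\<close>.\<close>
  define A where "A = ({1..N} \<times> {1..N}) \<times> {1-N\<^sup>2..0}"
  have sA: "J / 8 \<le> s x y z" if "((x, y), z) \<in> A" for x y z
  proof -
    have "1 / 8 \<le> (1 / 4^j) * (ell2_norm (\<lambda>k. F x y (z + 4^j) k - F x y z k))\<^sup>2" if j: "j < J" for j
    proof -
      have j4: "(4::int) ^ j \<le> N\<^sup>2" unfolding N2 using j by (intro power_increasing) auto
      have j0: "(0::int) < 4 ^ j" by simp
      have z: "\<bar>z\<bar> \<le> N\<^sup>2" "\<bar>z + 4 ^ j\<bar> \<le> N\<^sup>2"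
        using \<open>((x, y), z) \<in> A\<close> j4 j0 unfolding A_def mem_Times_iff atLeastAtMost_iff fst_conv snd_conv
        by linarith+
      have "\<phi> x y (z + 4^j) = 1" "\<phi> x y z = 1"
        using \<open>((x, y), z) \<in> A\<close> N1 z unfolding \<phi>_def by (auto simp: A_def intro!: box_cutoff_eq_1)
      then have "(\<lambda>k. F x y (z + 4^j) k - F x y z k) = (\<lambda>k. f (p x y (z + 4^j)) k - f (p x y z) k)"
        by (simp add: F_def g_def fun_eq_iff)
      then have "(2 * 2^j) powr (1 - \<epsilon>) \<le> ell2_norm (\<lambda>k. F x y (z + 4^j) k - F x y z k)"
        using lower[OF p p, of x y "z + 4^j" x y z] koranyi_dist_step_z[OF n, of x y z j]
        by (simp add: p_def)
      then have "((2 * 2^j) powr (1 - \<epsilon>))\<^sup>2 \<le> (ell2_norm (\<lambda>k. F x y (z + 4^j) k - F x y z k))\<^sup>2"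
        by (intro power_mono) auto
      moreover have "4^j / 8 \<le> ((2 * 2^j) powr (1 - \<epsilon>))\<^sup>2"
      proof -
        \<comment> \<open>Here the choice of \<open>J\<close> enters: the exponent of 2 drops below
          \<open>2 * j\<close> by at most 3, which gives the factor 1/8.\<close>
        have "\<epsilon> * j \<le> \<epsilon> * (1 / \<epsilon> + 1)" using J j \<epsilon> by (intro mult_left_mono) auto
        then have "\<epsilon> * j \<le> 3 / 2" using \<epsilon> by (simp add: algebra_simps)
        then have e: "2 * real j - 3 \<le> (1 + real j) * (1 - \<epsilon>) * 2"
          using \<epsilon> by (simp add: algebra_simps)
        have "(4::real)^j / 8 = 2 powr (2 * real j - 3)"
          by (simp add: powr_diff powr_mult_base powr_realpow[symmetric] powr_powr[symmetric])
        also have "\<dots> \<le> 2 powr ((1 + real j) * (1 - \<epsilon>) * 2)" using e by (intro powr_mono) auto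
        also have "\<dots> = ((2 * 2^j) powr (1 - \<epsilon>))\<^sup>2"
        proof -
          have "(2 * 2^j :: real) = 2 powr (1 + real j)" by (simp add: powr_add powr_realpow)
          then show ?thesis by (simp add: powr_powr powr_power mult.commute)
        qed
        finally show ?thesis .
      qed
      ultimately show ?thesis by (simp add: field_simps)
    qed
    then have "real (card {..<J}) * (1 / 8) \<le> s x y z"
      unfolding s_def by (intro sum_bounded_below) auto
    then show ?thesis by simp
  qed
  have s0: "0 \<le> s x y z" for x y z by (simp add: s_def sum_nonneg)
  have lhs: "N^4 * (J / 8) \<le> (\<Sum>(x,y)\<in>T\<times>T. \<Sum>z\<in>T. s x y z)"
  proof -
    have "int (card A) = N^4"
      using N1 by (simp add: A_def card_cartesian_product power2_eq_square power4_eq_xxxx)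
    then have "N^4 * (J / 8) = of_nat (card A) * (J / 8)" by (metis of_int_of_nat_eq)
    also have "\<dots> \<le> (\<Sum>q\<in>A. s (fst (fst q)) (snd (fst q)) (snd q))"
      by (rule sum_bounded_below) (rule sA, simp)
    also have "\<dots> \<le> (\<Sum>q\<in>(T\<times>T)\<times>T. s (fst (fst q)) (snd (fst q)) (snd q))"
    proof (rule sum_mono2)
      show "A \<subseteq> (T\<times>T)\<times>T" using NN N1 by (auto simp: A_def T_def R_def)
    qed (auto simp: T_def s0)
    also have "\<dots> = (\<Sum>(x,y)\<in>T\<times>T. \<Sum>z\<in>T. s x y z)"
      by (simp add: sum.cartesian_product case_prod_unfold)
    finally show ?thesis .
  qed

  \<comment> \<open>Comparison of the two sides\<close>
  have "N^4 * (J / 8) \<le> 27 * (441 * N^4 * (1768 * D\<^sup>2))"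
    using lhs main rhs unfolding s_def t_def by linarith
  then have "real_of_int N^4 * J \<le> real_of_int N^4 * (168412608 * D\<^sup>2)" by simp
  then have "J \<le> 168412608 * D\<^sup>2" using N1 by (subst (asm) mult_le_cancel_left_pos) auto
  \<comment> \<open>168412608 = 8 * 27 * 441 * 1768 is below 13000^2 = 169000000.\<close>
  also have "\<dots> \<le> (13000 * D)\<^sup>2" by (simp add: power_mult_distrib)
  finally have "1 / \<epsilon> \<le> (13000 * D)\<^sup>2" using J by linarith
  then have "sqrt (1 / \<epsilon>) \<le> sqrt ((13000 * D)\<^sup>2)" by (rule real_sqrt_le_mono)
  also have "\<dots> = 13000 * D" using D by (simp only: real_sqrt_abs)
  finally show ?thesis by (simp add: real_sqrt_divide)
qed

theorem mainTheorem4: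
  shows "\<exists>c\<^sub>0 :: real. c\<^sub>0 > 0 \<and>
    (\<forall>n :: nat. n \<ge> 1 \<longrightarrow> (\<forall>\<epsilon> :: real. 0 < \<epsilon> \<and> \<epsilon> < 1/2 \<longrightarrow>
      euclidean_distortion (heisenberg n) (\<lambda>g h. koranyi_dist n g h powr (1 - \<epsilon>))
        \<ge> ereal (c\<^sub>0 / sqrt \<epsilon>)))"
proof (intro exI[of _ "1/13000 :: real"] conjI allI impI)
  fix n :: nat and \<epsilon> :: real
  assume n: "n \<ge> 1" and \<epsilon>: "0 < \<epsilon> \<and> \<epsilon> < 1/2"
  show "euclidean_distortion (heisenberg n) (\<lambda>g h. koranyi_dist n g h powr (1 - \<epsilon>)) \<ge> ereal (1/13000 / sqrt \<epsilon>)"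
    unfolding euclidean_distortion_def
  \<comment> \<open>Bounding every admissible \<open>D\<close> bounds the infimum, also when no
    \<open>D\<close> is admissible and the infimum is \<open>\<infinity>\<close>.\<close>
  proof (rule Inf_greatest, clarify)
    fix D f
    assume "1 \<le> D" "f \<in> heisenberg n \<rightarrow> ell2"
      "\<forall>x\<in>heisenberg n. \<forall>y\<in>heisenberg n. koranyi_dist n x y powr (1 - \<epsilon>) \<le> ell2_norm (\<lambda>k. f x k - f y k) \<and>
         ell2_norm (\<lambda>k. f x k - f y k) \<le> D * koranyi_dist n x y powr (1 - \<epsilon>)"
    then have "1/13000 / sqrt \<epsilon> \<le> D" using n \<epsilon> by (intro snowflake_distortion_ge[of n \<epsilon> D f]) auto
    then show "ereal (1/13000 / sqrt \<epsilon>) \<le> ereal D" by simp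
  qed
qed simp

end
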